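(* Let $\mathcal C\subset\mathbb R^d$ be an open convex set and let $\mathcal D=\{q_1,\dots,q_N\}\subset\mathbb R^d$ be a dataset. Then $\mathcal D$ is a sufficient decision dataset for uncertainty set $\mathcal C$ and decision set $\mathcal X$ if and only if $\Delta(\mathcal X,\mathcal C)\subset \mathrm{span}\,\mathcal D$.
   Context: The decision set is $\mathcal X=\{x\in\mathbb R^d : Ax=b,\ x\ge 0\}$ with $A\in\mathbb R^{m\times d}$, $b\in\mathbb R^m$, assumed bounded. A dataset is a finite set $\mathcal D=\{q_1,\dots,q_N\}\subset\mathbb R^d$. Sufficiency: $\mathcal D=\{q_1,\dots,q_N\}$ is a sufficient decision dataset for $\mathcal C\subset\mathbb R^d$ and $\mathcal X$ if there exists a mapping $\hat X:\mathbb R^N\to\mathcal P(\mathcal X)$ (the set of subsets of $\mathcal X$) such that for all $c\in\mathcal C$, $\hat X(c^\top q_1,\dots,c^\top q_N)=\arg\min_{x\in\mathcal X}c^\top x$. Notation: $\mathcal X^\angle$ is the set of extreme points of $\mathcal X$. For $x^\star\in\mathcal X^\angle$: - $\mathrm{FD}(x^\star)=\{\delta\in\mathbb R^d:\exists\varepsilon>0,\ x^\star+\varepsilon\delta\in\mathcal X\}$ is the cone of feasible directions; - $D(x^\star)$ is the set of extreme directions of $\mathrm{FD}(x^\star)$: the non-zero vectors of $\mathrm{FD}(x^\star)$ that cannot be written as a convex combination $\lambda u+(1-\lambda)v$, $\lambda\in(0,1)$, of two non-proportional (i.e. linearly independent) elements $u,v$ of $\mathrm{FD}(x^\star)$; -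 $\Lambda(x^\star)=\{c\in\mathbb R^d: x^\star\in\arg\min_{x\in\mathcal X}c^\top x\}$; - for $\delta\in D(x^\star)$, $F(x^\star,\delta)=\Lambda(x^\star)\cap\{\delta\}^\perp$. The set of relevant extreme directions is $$\Delta(\mathcal X,\mathcal C)=\{\delta\in\mathbb R^d:\exists x^\star\in\mathcal X^\angle,\ \delta\in D(x^\star)\text{ and }F(x^\star,\delta)\cap\mathcal C\ne\varnothing\}.$$ *)

theory Defs
  imports "HOL-Analysis.Analysis"
begin

definition decision_set :: "real^'d^'m \<Rightarrow> real^'m \<Rightarrow> (real^'d) set" where
  "decision_set A b = {x. A *v x = b \<and> (\<forall>i. 0 \<le> x $ i)}"

definition argmin_set :: "'a::euclidean_space set \<Rightarrow> 'a \<Rightarrow> 'a set" where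
  "argmin_set X c = {x. is_arg_min (\<lambda>y. c \<bullet> y) (\<lambda>y. y \<in> X) x}"

text \<open>A dataset is given by an enumeration \<open>qs\<close> of its elements. The space of observation vectors
  \<open>\<real>\<^sup>N\<close> is the set of real lists of length \<open>N = length qs\<close>, which allows every \<open>N \<ge> 0\<close>; the
  values of the mapping on lists of other lengths are irrelevant.\<close>

definition sufficient_dataset ::
    "'a::euclidean_space list \<Rightarrow> 'a set \<Rightarrow> 'a set \<Rightarrow> bool" where
  "sufficient_dataset qs C X \<longleftrightarrow>
     (\<exists>Xhat \<in> {v :: real list. length v = length qs} \<rightarrow> Pow X.
        \<forall>c\<in>C. Xhat (map (\<lambda>q. c \<bullet> q) qs) = argmin_set X c)"

definition feasible_directions :: "'a::euclidean_space set \<Rightarrow> 'a \<Rightarrow> 'a set" where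
  "feasible_directions X x = {\<delta>. \<exists>\<epsilon>>0. x + \<epsilon> *\<^sub>R \<delta> \<in> X}"

text \<open>The condition \<open>u \<noteq> v\<close> is needed below because \<open>independent {u, u}\<close> holds
  for every non-zero \<open>u\<close>.\<close>

definition extreme_directions :: "'a::euclidean_space set \<Rightarrow> 'a \<Rightarrow> 'a set" where
  "extreme_directions X x =
     {\<delta> \<in> feasible_directions X x. \<delta> \<noteq> 0 \<and>
        \<not> (\<exists>u \<in> feasible_directions X x. \<exists>v \<in> feasible_directions X x. \<exists>t::real.
             u \<noteq> v \<and> independent {u, v} \<and> 0 < t \<and> t < 1 \<and>
             \<delta> = t *\<^sub>R u + (1 - t) *\<^sub>R v)}"

definition optimality_cone :: "'a::euclidean_space set \<Rightarrow> 'a \<Rightarrow> 'a set" where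
  "optimality_cone X x = {c. x \<in> argmin_set X c}"

definition optimality_face :: "'a::euclidean_space set \<Rightarrow> 'a \<Rightarrow> 'a \<Rightarrow> 'a set" where
  "optimality_face X x \<delta> = optimality_cone X x \<inter> orthogonal_comp {\<delta>}"

definition relevant_directions :: "'a::euclidean_space set \<Rightarrow> 'a set \<Rightarrow> 'a set" where
  "relevant_directions X C =
     {\<delta>. \<exists>x. x extreme_point_of X \<and> \<delta> \<in> extreme_directions X x \<and>
           optimality_face X x \<delta> \<inter> C \<noteq> {}}"

end

theory Submission
  imports Defs
begin

text \<open>
  Sufficiency means that two costs in \<open>C\<close> with the same observations, that is, whose difference is
  orthogonal to the dataset, have the same minimizers. If a relevant direction \<open>\<delta>\<close> at \<open>x\<close> lies
  outside the span, then some \<open>z\<close> orthogonal to the dataset has \<open>z \<bullet> \<delta> \<noteq> 0\<close>; moving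
  \<open>c \<in> F(x, \<delta>) \<inter> C\<close> slightly along \<open>z\<close> keeps the observations but cannot keep all of an
  initial segment from \<open>x\<close> in direction \<open>\<delta>\<close> optimal.

  Conversely, the cone of feasible directions at a vertex \<open>x\<close> is generated by finitely many extreme
  directions. If \<open>x\<close> is optimal for \<open>c\<close> but not for \<open>c'\<close>, move from \<open>c\<close> to \<open>c'\<close> along
  the segment and stop when the first generator \<open>\<delta>\<close> is about to become a descent direction. At that
  moment the cost lies in \<open>F(x, \<delta>) \<inter> C\<close>, so \<open>\<delta>\<close> is relevant although \<open>c - c'\<close> is not
  orthogonal to it. Hence \<open>c\<close> and \<open>c'\<close> have the same optimal vertices.
\<close>

section \<open>Finitely generated cones and their irredundant generators\<close>

lemma convex_cone_hull_insert_decomp: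
  fixes S :: "'a::real_vector set"
  assumes "y \<in> convex_cone hull (insert s S)"
  obtains a z where "0 \<le> a" "z \<in> convex_cone hull S" "y = a *\<^sub>R s + z"
proof -
  \<comment> \<open>\<open>?K\<close> is itself a convex cone and contains all generators, so
    minimality of the hull puts \<open>y\<close> into it.\<close>
  let ?K = "{a *\<^sub>R s + z | a z. 0 \<le> a \<and> z \<in> convex_cone hull S}"
  have "insert s S \<subseteq> ?K"
  proof (rule subsetI)
    fix x assume "x \<in> insert s S"
    then consider "x = 1 *\<^sub>R s + 0" | "x \<in> S" "x = 0 *\<^sub>R s + x" by auto
    then show "x \<in> ?K"
      using convex_cone_hull_contains_0[of S] hull_inc[of x S convex_cone]
      by cases (use zero_le_one in blast)+
  qed
  moreover have "convex_cone ?K"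
  proof -
    have "(0::'a) = 0 *\<^sub>R s + 0" by simp
    then have zero: "0 \<in> ?K" using convex_cone_hull_contains_0[of S] by blast
    have add: "x + y \<in> ?K" if xy: "x \<in> ?K" "y \<in> ?K" for x y
    proof -
      from xy obtain a z b w where *: "x = a *\<^sub>R s + z" "y = b *\<^sub>R s + w" "0 \<le> a" "0 \<le> b"
        "z \<in> convex_cone hull S" "w \<in> convex_cone hull S" by blast
      then have "x + y = (a + b) *\<^sub>R s + (z + w)" by (simp add: algebra_simps)
      then show ?thesis using * convex_cone_hull_add[of z S w] add_nonneg_nonneg[of a b] by blast
    qed
    have scale: "c *\<^sub>R x \<in> ?K" if xc: "x \<in> ?K" "0 \<le> c" for x and c :: real
    proof -
      from xc obtain a z where *: "x = a *\<^sub>R s + z" "0 \<le> a" "z \<in> convex_cone hull S" by blast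
      then have "c *\<^sub>R x = (c * a) *\<^sub>R s + c *\<^sub>R z" by (simp add: algebra_simps)
      then show ?thesis
        using * xc(2) convex_cone_hull_mul[of z S c] mult_nonneg_nonneg[of c a] by blast
    qed
    show ?thesis by (intro iffD2[OF convex_cone_iff] conjI ballI allI impI zero add scale)
  qed
  ultimately have "convex_cone hull (insert s S) \<subseteq> ?K" by (rule hull_minimal)
  then show thesis using assms that by blast
qed

text \<open>Dropping a generator that lies in the cone of the others leaves the hull unchanged;
  finiteness ends the process.\<close>

lemma finite_irredundant_generators:
  fixes S :: "'a::real_vector set"
  assumes "finite S"
  obtains T where "T \<subseteq> S" "convex_cone hull T = convex_cone hull S"
    "\<And>s. s \<in> T \<Longrightarrow> s \<notin> convex_cone hull (T - {s})"
proof -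
  from assms have "\<exists>T\<subseteq>S. convex_cone hull T = convex_cone hull S \<and>
      (\<forall>s\<in>T. s \<notin> convex_cone hull (T - {s}))"
  proof (induction S rule: finite_psubset_induct)
    case (psubset S)
    show ?case
    proof (cases "\<exists>s\<in>S. s \<in> convex_cone hull (S - {s})")
      case True
      then obtain s where s: "s \<in> S" "s \<in> convex_cone hull (S - {s})" by blast
      then have "convex_cone hull S = convex_cone hull (S - {s})"
        using hull_redundant[of s convex_cone "S - {s}"] by (simp add: insert_absorb)
      moreover have "S - {s} \<subset> S" using s by blast
      ultimately show ?thesis using psubset.IH[of "S - {s}"] by blast
    qed blast
  qed
  then show thesis using that by blast
qed

text \<open>Splitting \<open>u\<close> and \<open>v\<close> into a multiple of \<open>s\<close> plus
  a rest in the cone of the other generators gives \<open>s = \<alpha> *\<^sub>R s + r\<close>. If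
  \<open>\<alpha> < 1\<close>, then \<open>s\<close> is redundant; otherwise \<open>r\<close> and
  \<open>- r\<close> both lie in the pointed cone. So the rests vanish, and \<open>u\<close> and
  \<open>v\<close> are multiples of \<open>s\<close>.\<close>

lemma irredundant_generator_extreme:
  fixes S :: "'a::real_vector set"
  assumes pointed: "\<And>k. k \<in> convex_cone hull S \<Longrightarrow> - k \<in> convex_cone hull S \<Longrightarrow> k = 0"
    and s: "s \<in> S" "s \<notin> convex_cone hull (S - {s})"
    and uv: "u \<in> convex_cone hull S" "v \<in> convex_cone hull S" "u \<noteq> v"
    and t: "0 < t" "t < 1" "s = t *\<^sub>R u + (1 - t) *\<^sub>R v"
  shows "dependent {u, v}"
proof -
  let ?H = "convex_cone hull (S - {s})"
  have S: "insert s (S - {s}) = S" using s by blast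
  have HK: "?H \<subseteq> convex_cone hull S" by (rule hull_mono) blast
  obtain a p where p: "0 \<le> a" "p \<in> ?H" "u = a *\<^sub>R s + p"
    using convex_cone_hull_insert_decomp[of u s "S - {s}"] uv(1) unfolding S by blast
  obtain b q where q: "0 \<le> b" "q \<in> ?H" "v = b *\<^sub>R s + q"
    using convex_cone_hull_insert_decomp[of v s "S - {s}"] uv(2) unfolding S by blast
  define \<alpha> where "\<alpha> = t * a + (1 - t) * b"
  define r where "r = t *\<^sub>R p + (1 - t) *\<^sub>R q"
  have tp: "t *\<^sub>R p \<in> ?H" and tq: "(1 - t) *\<^sub>R q \<in> ?H"
    using p(2) q(2) t(1,2) by (auto intro: convex_cone_hull_mul)
  then have r: "r \<in> ?H" unfolding r_def by (rule convex_cone_hull_add)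
  have "s = \<alpha> *\<^sub>R s + r"
    using t(3) unfolding p q \<alpha>_def r_def by (simp add: algebra_simps)
  then have r_eq: "r = (1 - \<alpha>) *\<^sub>R s" by (simp add: algebra_simps)
  have "1 \<le> \<alpha>"
  proof (rule ccontr)
    assume "\<not> 1 \<le> \<alpha>"
    then have "s = (1 / (1 - \<alpha>)) *\<^sub>R r" "0 \<le> 1 / (1 - \<alpha>)" using r_eq by auto
    then show False using convex_cone_hull_mul[OF r] s by metis
  qed
  then have "(\<alpha> - 1) *\<^sub>R s \<in> convex_cone hull S"
    using s(1) by (intro convex_cone_hull_mul hull_inc) auto
  moreover have "- r = (\<alpha> - 1) *\<^sub>R s" unfolding r_eq by (simp add: algebra_simps)
  \<comment> \<open>Since \<open>r = 0\<close>, its two summands are opposite elements of the cone,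
    and pointedness applies a second time.\<close>
  ultimately have "r = 0" using pointed[of r] r HK by auto
  then have "- (t *\<^sub>R p) = (1 - t) *\<^sub>R q" unfolding r_def by (simp add: add_eq_0_iff)
  then have "t *\<^sub>R p = 0" using pointed[of "t *\<^sub>R p"] tp tq HK by auto
  with \<open>- (t *\<^sub>R p) = (1 - t) *\<^sub>R q\<close> t have "p = 0" "q = 0" by auto
  then have uv_eq: "u = a *\<^sub>R s" "v = b *\<^sub>R s" using p q by auto
  show ?thesis
  proof (cases "b = 0")
    case True
    then show ?thesis using uv_eq by (simp add: dependent_zero)
  next
    case False
    then have "u = (a / b) *\<^sub>R v" using uv_eq by simp
    then have "u \<in> span ({u, v} - {u})"
      using \<open>u \<noteq> v\<close> by (metis Diff_iff empty_iff insertCI insertE span_base span_mul)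
    then show ?thesis unfolding dependent_def by blast
  qed
qed

section \<open>Feasible directions and optimality of a vertex\<close>

lemma argmin_set_iff:
  "x \<in> argmin_set X c \<longleftrightarrow> x \<in> X \<and> (\<forall>y\<in>X. c \<bullet> x \<le> c \<bullet> y)"
  by (auto simp: argmin_set_def is_arg_min_def not_less)

lemma feasible_directions_diff:
  assumes "y \<in> X"
  shows "y - x \<in> feasible_directions X x"
  unfolding feasible_directions_def using assms by (auto intro!: exI[of _ 1])

lemma convex_cone_feasible_directions:
  assumes "convex X" "x \<in> X"
  shows "convex_cone (feasible_directions X x)"
  unfolding convex_cone_iff
proof (intro conjI ballI allI impI)
  show "0 \<in> feasible_directions X x"
    using feasible_directions_diff[OF assms(2), of x] by simp
next
  fix d e assume "d \<in> feasible_directions X x" "e \<in> feasible_directions X x"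
  then obtain \<alpha> \<beta> where *: "0 < \<alpha>" "0 < \<beta>" "x + \<alpha> *\<^sub>R d \<in> X" "x + \<beta> *\<^sub>R e \<in> X"
    unfolding feasible_directions_def by blast
  let ?s = "\<alpha> + \<beta>"
  \<comment> \<open>The weights are chosen so that \<open>d\<close> and \<open>e\<close> receive the
    same coefficient.\<close>
  have "(\<beta> / ?s) *\<^sub>R (x + \<alpha> *\<^sub>R d) + (\<alpha> / ?s) *\<^sub>R (x + \<beta> *\<^sub>R e) \<in> X"
    using * assms(1) by (intro convexD) (auto simp: add_divide_distrib[symmetric])
  moreover have "(\<beta> / ?s) *\<^sub>R (x + \<alpha> *\<^sub>R d) + (\<alpha> / ?s) *\<^sub>R (x + \<beta> *\<^sub>R e)
      = (\<beta> / ?s + \<alpha> / ?s) *\<^sub>R x + (\<alpha> * \<beta> / ?s) *\<^sub>R (d + e)"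
    by (simp add: algebra_simps)
  moreover have "\<beta> / ?s + \<alpha> / ?s = 1" "\<alpha> * \<beta> / ?s > 0"
    using * by (auto simp: add_divide_distrib[symmetric])
  ultimately show "d + e \<in> feasible_directions X x"
    unfolding feasible_directions_def by (metis (mono_tags, lifting) mem_Collect_eq scaleR_one)
next
  fix d and k :: real assume "d \<in> feasible_directions X x" and k: "0 \<le> k"
  then obtain \<alpha> where *: "0 < \<alpha>" "x + \<alpha> *\<^sub>R d \<in> X"
    unfolding feasible_directions_def by blast
  show "k *\<^sub>R d \<in> feasible_directions X x"
  proof (cases "k = 0")
    case True
    then show ?thesis using feasible_directions_diff[OF assms(2), of x] by simp
  next
    case False
    then have "0 < \<alpha> / k" "(\<alpha> / k) *\<^sub>R (k *\<^sub>R d) = \<alpha> *\<^sub>R d" using k * by auto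
    then show ?thesis unfolding feasible_directions_def using * by (metis (mono_tags, lifting) mem_Collect_eq)
  qed
qed

text \<open>For finite \<open>V\<close> this makes the cone finitely generated. The inclusion of
  feasible directions in the hull holds because \<open>x\<close> plus the generated cone is convex
  and contains \<open>V\<close>.\<close>

lemma feasible_directions_convex_hull:
  fixes V :: "'a::euclidean_space set"
  assumes "x \<in> convex hull V"
  shows "feasible_directions (convex hull V) x = convex_cone hull ((\<lambda>v. v - x) ` V)"
proof
  show "convex_cone hull ((\<lambda>v. v - x) ` V) \<subseteq> feasible_directions (convex hull V) x"
    using assms by (intro hull_minimal convex_cone_feasible_directions)
      (auto intro: feasible_directions_diff hull_inc)
next
  let ?K = "convex_cone hull ((\<lambda>v. v - x) ` V)"
  have "convex hull V \<subseteq> (\<lambda>k. x + k) ` ?K"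
  proof (intro hull_minimal convex_translation convex_convex_cone_hull subsetI)
    fix v assume "v \<in> V"
    then have "v - x \<in> ?K" by (intro hull_inc) blast
    then show "v \<in> (\<lambda>k. x + k) ` ?K" by (auto intro: image_eqI[of _ _ "v - x"])
  qed
  then have sub: "y - x \<in> ?K" if "y \<in> convex hull V" for y using that by auto
  show "feasible_directions (convex hull V) x \<subseteq> ?K"
  proof
    fix d assume "d \<in> feasible_directions (convex hull V) x"
    then obtain \<epsilon> where e: "0 < \<epsilon>" "x + \<epsilon> *\<^sub>R d \<in> convex hull V"
      unfolding feasible_directions_def by blast
    then have "\<epsilon> *\<^sub>R d \<in> ?K" using sub by force
    from convex_cone_hull_mul[OF this, of "1 / \<epsilon>"] e show "d \<in> ?K" by simp
  qed
qed

lemma feasible_directions_extreme_point_pointed: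
  fixes X :: "'a::euclidean_space set"
  assumes "convex X" "x extreme_point_of X"
    and "k \<in> feasible_directions X x" "- k \<in> feasible_directions X x"
  shows "k = 0"
proof (rule ccontr)
  assume "k \<noteq> 0"
  obtain \<alpha> \<beta> where *: "0 < \<alpha>" "0 < \<beta>" "x + \<alpha> *\<^sub>R k \<in> X" "x - \<beta> *\<^sub>R k \<in> X"
    using assms(3,4) unfolding feasible_directions_def by auto
  \<comment> \<open>The weight for which the displacements along \<open>k\<close> and
    \<open>- k\<close> cancel, so that \<open>x\<close> is strictly between the two points.\<close>
  let ?t = "\<beta> / (\<alpha> + \<beta>)"
  have "x - \<beta> *\<^sub>R k \<noteq> x + \<alpha> *\<^sub>R k"
  proof
    assume "x - \<beta> *\<^sub>R k = x + \<alpha> *\<^sub>R k"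
    then have "(\<alpha> + \<beta>) *\<^sub>R k = 0" by (simp add: algebra_simps)
    then show False using * \<open>k \<noteq> 0\<close> by simp
  qed
  moreover have "x = (1 - ?t) *\<^sub>R (x - \<beta> *\<^sub>R k) + ?t *\<^sub>R (x + \<alpha> *\<^sub>R k)"
  proof -
    have "(1 - ?t) *\<^sub>R (x - \<beta> *\<^sub>R k) + ?t *\<^sub>R (x + \<alpha> *\<^sub>R k)
        = x + (?t * \<alpha> - (1 - ?t) * \<beta>) *\<^sub>R k" by (simp add: algebra_simps)
    moreover have "?t * \<alpha> - (1 - ?t) * \<beta> = 0" using * by (simp add: field_simps)
    ultimately show ?thesis by simp
  qed
  moreover have "0 < ?t" "?t < 1" using * by auto
  ultimately have "x \<in> open_segment (x - \<beta> *\<^sub>R k) (x + \<alpha> *\<^sub>R k)"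
    unfolding in_segment by blast
  then show False using assms(2) * unfolding extreme_point_of_def by blast
qed

lemma argmin_set_iff_feasible_directions:
  assumes "x \<in> X"
  shows "x \<in> argmin_set X c \<longleftrightarrow> (\<forall>d\<in>feasible_directions X x. 0 \<le> c \<bullet> d)"
proof
  assume opt: "x \<in> argmin_set X c"
  show "\<forall>d\<in>feasible_directions X x. 0 \<le> c \<bullet> d"
  proof
    fix d assume "d \<in> feasible_directions X x"
    then obtain \<epsilon> where e: "0 < \<epsilon>" "x + \<epsilon> *\<^sub>R d \<in> X"
      unfolding feasible_directions_def by blast
    then have "c \<bullet> x \<le> c \<bullet> (x + \<epsilon> *\<^sub>R d)" using opt argmin_set_iff by blast
    then show "0 \<le> c \<bullet> d" using e by (simp add: inner_add_right zero_le_mult_iff)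
  qed
next
  assume nonneg: "\<forall>d\<in>feasible_directions X x. 0 \<le> c \<bullet> d"
  have "c \<bullet> x \<le> c \<bullet> y" if "y \<in> X" for y
    using bspec[OF nonneg feasible_directions_diff[OF that]] by (simp add: inner_diff_right)
  then show "x \<in> argmin_set X c" using assms argmin_set_iff by blast
qed

text \<open>Reduces optimality at a vertex to finitely many inequalities, all indexed by extreme
  directions: irredundant generators of a pointed cone are extreme, and a linear form that is
  nonnegative on generators is nonnegative on their cone.\<close>

lemma polytope_vertex_finite_extreme_directions:
  fixes X :: "'a::euclidean_space set"
  assumes "polytope X" "x extreme_point_of X"
  obtains T where "finite T" "T \<subseteq> extreme_directions X x"
    "\<And>c. x \<in> argmin_set X c \<longleftrightarrow> (\<forall>d\<in>T. 0 \<le> c \<bullet> d)"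
proof -
  obtain V where V: "finite V" "X = convex hull V"
    using assms(1) unfolding polytope_def by blast
  have xX: "x \<in> X" using assms(2) by (simp add: extreme_point_of_def)
  let ?S = "(\<lambda>v. v - x) ` V"
  obtain T where T: "T \<subseteq> ?S" "convex_cone hull T = convex_cone hull ?S"
    "\<And>s. s \<in> T \<Longrightarrow> s \<notin> convex_cone hull (T - {s})"
    using finite_irredundant_generators[of ?S] V(1) by blast
  have FD: "feasible_directions X x = convex_cone hull T"
    using feasible_directions_convex_hull xX V T by blast
  have pointed: "k = 0" if "k \<in> convex_cone hull T" "- k \<in> convex_cone hull T" for k
    using feasible_directions_extreme_point_pointed[OF polytope_imp_convex assms(2), of k]
      assms(1) that FD by blast
  show thesis
  proof
    show "finite T" using T(1) V(1) finite_subset by blast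
    show "T \<subseteq> extreme_directions X x"
    proof
      fix s assume s: "s \<in> T"
      \<comment> \<open>Every cone hull contains 0, so a zero generator would be redundant.\<close>
      have "s \<noteq> 0" using T(3)[OF s] convex_cone_hull_contains_0 by metis
      moreover have "s \<in> convex_cone hull T" using s by (rule hull_inc)
      ultimately show "s \<in> extreme_directions X x"
        using irredundant_generator_extreme[OF pointed s T(3)[OF s]]
        unfolding extreme_directions_def FD by blast
    qed
    show "x \<in> argmin_set X c \<longleftrightarrow> (\<forall>d\<in>T. 0 \<le> c \<bullet> d)" for c
    proof -
      have "convex_cone hull T \<subseteq> {d. 0 \<le> c \<bullet> d}" if "\<forall>d\<in>T. 0 \<le> c \<bullet> d"
        using that by (intro hull_minimal convex_cone_halfspace_ge) blast
      then show ?thesis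
        unfolding argmin_set_iff_feasible_directions[OF xX] FD
        using hull_inc[of _ T convex_cone] by blast
    qed
  qed
qed

section \<open>Moving along a segment of costs\<close>

lemma first_sign_change:
  fixes f g :: "'a \<Rightarrow> real"
  assumes "finite T" "\<And>d. d \<in> T \<Longrightarrow> 0 \<le> f d" "e \<in> T" "g e < 0"
  obtains d t where "d \<in> T" "g d < 0" "0 \<le> t" "t \<le> 1" "(1 - t) * f d + t * g d = 0"
    "\<And>d'. d' \<in> T \<Longrightarrow> 0 \<le> (1 - t) * f d' + t * g d'"
proof -
  let ?N = "{d \<in> T. g d < 0}"
  \<comment> \<open>For \<open>d\<close> in \<open>?N\<close>, the parameter at which the
    interpolation from \<open>f d\<close> to \<open>g d\<close> reaches zero. The least such value
    is the first crossing, and up to it no element of \<open>T\<close> has become negative.\<close>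
  define \<tau> where "\<tau> d = f d / (f d - g d)" for d
  have "finite ?N" "?N \<noteq> {}" using assms by auto
  then obtain d where d: "d \<in> ?N" "\<And>d'. d' \<in> ?N \<Longrightarrow> \<tau> d \<le> \<tau> d'"
    by (meson arg_min_if_finite(1) arg_min_least)
  have pos: "0 < f d' - g d'" if "d' \<in> ?N" for d' using assms(2)[of d'] that by auto
  have t: "0 \<le> \<tau> d" "\<tau> d \<le> 1"
    using pos[OF d(1)] assms(2)[of d] d(1) by (auto simp: \<tau>_def divide_le_eq_1)
  show thesis
  proof
    show "d \<in> T" "g d < 0" using d by auto
    show "0 \<le> \<tau> d" "\<tau> d \<le> 1" by fact+
    show "(1 - \<tau> d) * f d + \<tau> d * g d = 0"
      using pos[OF d(1)] by (simp add: \<tau>_def field_simps)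
    show "0 \<le> (1 - \<tau> d) * f d' + \<tau> d * g d'" if d': "d' \<in> T" for d'
    proof (cases "g d' < 0")
      case True
      then have N: "d' \<in> ?N" using d' by simp
      have "\<tau> d * (f d' - g d') \<le> \<tau> d' * (f d' - g d')"
        using d(2)[OF N] pos[OF N] by (intro mult_right_mono) auto
      also have "\<dots> = f d'" using pos[OF N] by (simp add: \<tau>_def)
      finally show ?thesis by (simp add: algebra_simps)
    next
      case False
      then show ?thesis using t assms(2)[OF d'] by auto
    qed
  qed
qed

lemma optimal_vertex_transfer:
  fixes X :: "'a::euclidean_space set"
  assumes "polytope X" "convex C" "c \<in> C" "c' \<in> C"
    and orth: "\<And>d. d \<in> relevant_directions X C \<Longrightarrow> c \<bullet> d = c' \<bullet> d"
    and x: "x extreme_point_of X" "x \<in> argmin_set X c"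
  shows "x \<in> argmin_set X c'"
proof (rule ccontr)
  assume not_opt: "x \<notin> argmin_set X c'"
  obtain T where T: "finite T" "T \<subseteq> extreme_directions X x"
    "\<And>c. x \<in> argmin_set X c \<longleftrightarrow> (\<forall>d\<in>T. 0 \<le> c \<bullet> d)"
    using polytope_vertex_finite_extreme_directions[OF assms(1) x(1)] by blast
  obtain e where e: "e \<in> T" "c' \<bullet> e < 0" using not_opt T(3) by force
  obtain d t where d: "d \<in> T" "c' \<bullet> d < 0" "0 \<le> t" "t \<le> 1"
    "(1 - t) * (c \<bullet> d) + t * (c' \<bullet> d) = 0"
    "\<And>d'. d' \<in> T \<Longrightarrow> 0 \<le> (1 - t) * (c \<bullet> d') + t * (c' \<bullet> d')"
    using first_sign_change[of T "\<lambda>d. c \<bullet> d" e "\<lambda>d. c' \<bullet> d"] T e x(2) by blast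
  \<comment> \<open>The cost at the first crossing: it is in \<open>C\<close> by convexity, still
    makes \<open>x\<close> optimal, and is orthogonal to \<open>d\<close>. This makes
    \<open>d\<close> relevant.\<close>
  define m where "m = (1 - t) *\<^sub>R c + t *\<^sub>R c'"
  have m_inner: "m \<bullet> y = (1 - t) * (c \<bullet> y) + t * (c' \<bullet> y)" for y
    by (simp add: m_def inner_add_left)
  have "m \<in> C" unfolding m_def using assms(2-4) d by (intro convexD) auto
  moreover have "x \<in> argmin_set X m" using T(3) d(6) m_inner by simp
  moreover have "m \<in> orthogonal_comp {d}"
    using d(5) m_inner by (simp add: orthogonal_comp_def orthogonal_def inner_commute)
  ultimately have "d \<in> relevant_directions X C"
    unfolding relevant_directions_def optimality_face_def optimality_cone_def
    using x(1) T(2) d(1) by blast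
  then have "c \<bullet> d = c' \<bullet> d" by (rule orth)
  \<comment> \<open>Optimality of \<open>x\<close> for \<open>c\<close> gives
    \<open>0 \<le> c \<bullet> d\<close>, against \<open>c' \<bullet> d < 0\<close>.\<close>
  then show False using d(1,2) T(3) x(2) by force
qed

section \<open>Minimizers as a face spanned by vertices\<close>

lemma argmin_set_face:
  assumes "convex X"
  shows "argmin_set X c face_of X"
proof (cases "argmin_set X c = {}")
  case False
  then obtain x where x: "x \<in> argmin_set X c" by blast
  \<comment> \<open>The hyperplane through \<open>x\<close> at the minimal cost supports
    \<open>X\<close>.\<close>
  then have "argmin_set X c = X \<inter> {y. c \<bullet> y = c \<bullet> x}"
    by (auto simp: argmin_set_iff intro: order_antisym)
  then show ?thesis
    using face_of_Int_supporting_hyperplane_ge[OF assms, where a = c and b = "c \<bullet> x"] x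
    unfolding argmin_set_iff by metis
qed simp

text \<open>By Minkowski, the compact face of minimizers is the hull of its extreme points, which
  are extreme in \<open>X\<close> too; convexity of the target extends the inclusion from them to
  the whole face.\<close>

lemma argmin_set_subset_if_vertices:
  fixes X :: "'a::euclidean_space set"
  assumes "polytope X"
    and "\<And>x. x extreme_point_of X \<Longrightarrow> x \<in> argmin_set X c \<Longrightarrow> x \<in> argmin_set X c'"
  shows "argmin_set X c \<subseteq> argmin_set X c'"
proof -
  have X: "convex X" "compact X"
    using assms(1) polytope_imp_convex polytope_imp_compact by auto
  have face: "argmin_set X d face_of X" for d by (rule argmin_set_face[OF X(1)])
  have "argmin_set X c = convex hull {x. x extreme_point_of argmin_set X c}"
    using Krein_Milman_Minkowski face_of_imp_compact[OF X face] face_of_imp_convex[OF face] by blast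
  also have "\<dots> \<subseteq> argmin_set X c'"
    using assms(2) extreme_point_of_face[OF face] face_of_imp_convex[OF face]
    by (intro hull_minimal) auto
  finally show ?thesis .
qed

section \<open>Sufficiency and the span of the dataset\<close>

lemma sufficient_dataset_iff:
  "sufficient_dataset qs C X \<longleftrightarrow>
    (\<forall>c\<in>C. \<forall>c'\<in>C. (\<forall>q\<in>set qs. c \<bullet> q = c' \<bullet> q) \<longrightarrow> argmin_set X c = argmin_set X c')"
proof
  assume "sufficient_dataset qs C X"
  then show "\<forall>c\<in>C. \<forall>c'\<in>C. (\<forall>q\<in>set qs. c \<bullet> q = c' \<bullet> q) \<longrightarrow> argmin_set X c = argmin_set X c'"
    unfolding sufficient_dataset_def by (metis (mono_tags, lifting) map_eq_conv)
next
  assume same: "\<forall>c\<in>C. \<forall>c'\<in>C. (\<forall>q\<in>set qs. c \<bullet> q = c' \<bullet> q) \<longrightarrow> argmin_set X c = argmin_set X c'"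
  define obs where "obs c = map (\<lambda>q. c \<bullet> q) qs" for c
  \<comment> \<open>Pools the minimizers of all costs in \<open>C\<close> that yield the observation
    \<open>v\<close>. By assumption these sets coincide; a vector that is never observed gets the
    empty set.\<close>
  define Xhat where "Xhat v = (\<Union>c\<in>{c \<in> C. obs c = v}. argmin_set X c)" for v
  have "Xhat v \<subseteq> X" for v by (auto simp: Xhat_def argmin_set_iff)
  moreover have "Xhat (obs c) = argmin_set X c" if "c \<in> C" for c
  proof -
    have "argmin_set X c' = argmin_set X c" if "c' \<in> C" "obs c' = obs c" for c'
    proof -
      have "\<forall>q\<in>set qs. c' \<bullet> q = c \<bullet> q" using that(2) by (simp add: obs_def)
      then show ?thesis using same that(1) \<open>c \<in> C\<close> by blast
    qed
    then show ?thesis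
      unfolding Xhat_def using \<open>c \<in> C\<close> by (intro SUP_eq_const) blast+
  qed
  ultimately show "sufficient_dataset qs C X"
    unfolding sufficient_dataset_def obs_def by (intro bexI[of _ Xhat]) auto
qed

text \<open>The witness is the component of \<open>d\<close> orthogonal to the span, for which
  \<open>z \<bullet> d = z \<bullet> z\<close>.\<close>

lemma orthogonal_separates_span:
  fixes d :: "'a::euclidean_space"
  assumes "d \<notin> span S"
  obtains z where "\<And>q. q \<in> S \<Longrightarrow> z \<bullet> q = 0" "z \<bullet> d \<noteq> 0"
proof -
  obtain y z where yz: "y \<in> span S" "\<And>w. w \<in> span S \<Longrightarrow> orthogonal z w" "d = y + z"
    using orthogonal_subspace_decomp_exists[of S d] by blast
  have "z \<noteq> 0" using yz assms by auto
  moreover have "z \<bullet> y = 0" using yz by (simp add: orthogonal_def)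
  ultimately have "z \<bullet> d \<noteq> 0" using yz(3) by (simp add: inner_add_right)
  moreover have "z \<bullet> q = 0" if "q \<in> S" for q
    using yz(2)[OF span_base[OF that]] by (simp add: orthogonal_def)
  ultimately show thesis using that by blast
qed

lemma sufficient_dataset_relevant_directions:
  fixes X :: "'a::euclidean_space set"
  assumes "open C" and suff: "sufficient_dataset qs C X"
  shows "relevant_directions X C \<subseteq> span (set qs)"
proof (rule subsetI, rule ccontr)
  fix d assume d: "d \<in> relevant_directions X C" "d \<notin> span (set qs)"
  then obtain x c where x: "d \<in> feasible_directions X x" "x \<in> argmin_set X c"
    and c: "c \<bullet> d = 0" "c \<in> C"
    unfolding relevant_directions_def optimality_face_def optimality_cone_def extreme_directions_def
    by (auto simp: orthogonal_comp_def orthogonal_def inner_commute)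
  obtain z where z: "\<And>q. q \<in> set qs \<Longrightarrow> z \<bullet> q = 0" "z \<bullet> d \<noteq> 0"
    using orthogonal_separates_span[OF d(2)] by blast
  obtain \<eta> where \<eta>: "0 < \<eta>" "ball c \<eta> \<subseteq> C" using assms(1) c(2) open_contains_ball by blast
  \<comment> \<open>Makes the perturbation have norm \<open>\<eta> / 2\<close>, inside the open
    ball.\<close>
  define \<epsilon> where "\<epsilon> = \<eta> / (2 * norm z)"
  have "z \<noteq> 0" using z(2) by auto
  then have "\<epsilon> \<noteq> 0" "norm (\<epsilon> *\<^sub>R z) < \<eta>" using \<eta> by (auto simp: \<epsilon>_def)
  then have "c + \<epsilon> *\<^sub>R z \<in> C" using \<eta> by (auto simp: dist_norm)
  moreover have "\<forall>q\<in>set qs. c \<bullet> q = (c + \<epsilon> *\<^sub>R z) \<bullet> q" using z(1) by (simp add: inner_add_left)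
  ultimately have same: "argmin_set X (c + \<epsilon> *\<^sub>R z) = argmin_set X c"
    using suff c(2) unfolding sufficient_dataset_iff by metis
  obtain \<delta> where \<delta>: "0 < \<delta>" "x + \<delta> *\<^sub>R d \<in> X"
    using x(1) unfolding feasible_directions_def by blast
  \<comment> \<open>Moving along \<open>d\<close> is free of cost under \<open>c\<close>, so the
    second point is optimal too. Both points then minimize the perturbed cost, whose values there
    differ by a nonzero multiple of \<open>z \<bullet> d\<close>.\<close>
  then have "x + \<delta> *\<^sub>R d \<in> argmin_set X c"
    using x(2) c(1) by (simp add: argmin_set_iff inner_add_right)
  with same x(2) have "(c + \<epsilon> *\<^sub>R z) \<bullet> x = (c + \<epsilon> *\<^sub>R z) \<bullet> (x + \<delta> *\<^sub>R d)"
    by (intro order_antisym) (metis argmin_set_iff)+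
  then have "\<delta> * (\<epsilon> * (z \<bullet> d)) = 0" using c(1) by (simp add: inner_add_left inner_add_right)
  then show False using \<delta>(1) \<open>\<epsilon> \<noteq> 0\<close> z(2) by simp
qed

lemma relevant_directions_sufficient_dataset:
  fixes X :: "'a::euclidean_space set"
  assumes "polytope X" "convex C" "relevant_directions X C \<subseteq> span (set qs)"
  shows "sufficient_dataset qs C X"
proof -
  have sub: "argmin_set X c \<subseteq> argmin_set X c'"
    if c: "c \<in> C" "c' \<in> C" and eq: "\<forall>q\<in>set qs. c \<bullet> q = c' \<bullet> q" for c c'
  proof -
    have "c \<bullet> d = c' \<bullet> d" if "d \<in> relevant_directions X C" for d
    proof -
      \<comment> \<open>Equal observations make \<open>c - c'\<close> orthogonal to the dataset,
        hence to its span and to every relevant direction.\<close>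
      have "orthogonal (c - c') q" if "q \<in> set qs" for q
        using eq that by (simp add: orthogonal_def inner_diff_left)
      then have "orthogonal (c - c') d" using orthogonal_to_span assms(3) that by blast
      then show ?thesis by (simp add: orthogonal_def inner_diff_left)
    qed
    then show ?thesis
      using optimal_vertex_transfer[OF assms(1,2) c] argmin_set_subset_if_vertices[OF assms(1)]
      by blast
  qed
  show ?thesis
    unfolding sufficient_dataset_iff
  proof (intro ballI impI)
    fix c c' assume "c \<in> C" "c' \<in> C" "\<forall>q\<in>set qs. c \<bullet> q = c' \<bullet> q"
    then show "argmin_set X c = argmin_set X c'" using sub[of c c'] sub[of c' c] by auto
  qed
qed

section \<open>The decision set as a polytope\<close>

lemma polyhedron_decision_set:
  fixes A :: "real^'d^'m" and b :: "real^'m"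
  shows "polyhedron (decision_set A b)"
proof -
  \<comment> \<open>One hyperplane per row of \<open>A\<close> and one halfspace per coordinate,
    finitely many in all.\<close>
  have "decision_set A b =
      \<Inter> (range (\<lambda>i. {x. row i A \<bullet> x = b $ i})) \<inter> \<Inter> (range (\<lambda>j. {x. axis j 1 \<bullet> x \<ge> 0}))"
    by (auto simp: decision_set_def vec_eq_iff matrix_vector_mul_component row_def inner_axis'
        vec_lambda_eta)
  then show ?thesis
    by (auto intro!: polyhedron_Int polyhedron_Inter polyhedron_hyperplane polyhedron_halfspace_ge)
qed

theorem theorem1:
  fixes A :: "real^'d^'m" and b :: "real^'m"
    and C :: "(real^'d) set" and qs :: "(real^'d) list"
  assumes "bounded (decision_set A b)"
    and "open C" and "convex C"
  shows "sufficient_dataset qs C (decision_set A b) \<longleftrightarrow>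
         relevant_directions (decision_set A b) C \<subseteq> span (set qs)"
proof -
  \<comment> \<open>Boundedness turns the polyhedron into the hull of finitely many points, the
    source of the finite generating sets.\<close>
  have "polytope (decision_set A b)"
    using assms(1) polyhedron_decision_set polytope_eq_bounded_polyhedron by blast
  then show ?thesis
    using assms(2,3) sufficient_dataset_relevant_directions relevant_directions_sufficient_dataset
    by blast
qed

end
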